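(* Let $\mathcal{A}$ be a unital associative algebra, $\Omega^1$ an $\mathcal{A}$-bimodule and $\mathrm{d},\bar{\mathrm{d}}:\mathcal{A}\to\Omega^1$ derivations. Let $\phi_0\in\mathcal{A}$, $\gamma\in\Omega^1$, and let $\Phi\in\mathcal{A}$ be invertible with $$\bar{\mathrm{d}}\Phi-(\mathrm{d}\Phi)\,\phi_0-\Phi\,\gamma=0 .$$ Set $\phi=\Phi\,\phi_0\,\Phi^{-1}$. Then $$\bar{\mathrm{d}}\phi-(\mathrm{d}\phi)\,\phi=0$$ holds if and only if $$\bar{\mathrm{d}}\phi_0-(\mathrm{d}\phi_0)\,\phi_0+[\gamma,\phi_0]=0 .$$ In particular, if $\phi_0$ solves the last equation, then $\phi=\Phi\,\phi_0\,\Phi^{-1}$ solves $\bar{\mathrm{d}}\phi-(\mathrm{d}\phi)\,\phi=0$.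
   Context: A derivation $\mathrm{d}:\mathcal{A}\to\Omega^1$ is a linear map with $\mathrm{d}(ab)=(\mathrm{d}a)\,b+a\,\mathrm{d}b$ for all $a,b\in\mathcal{A}$. For $\gamma\in\Omega^1$ and $a\in\mathcal{A}$, $[\gamma,a]:=\gamma\,a-a\,\gamma$. *)

theory Defs
  imports Complex_Main
begin

(* The sort {ring, monoid_mult} is used instead of ring_1 because ring_1 demands 0 \<noteq> 1 and
   would exclude the zero algebra. *)

locale unital_algebra = module scaleA
  for scaleA :: "'k::comm_ring_1 \<Rightarrow> 'a::{ring, monoid_mult} \<Rightarrow> 'a" +
  assumes scale_mult_left: "scaleA c a * b = scaleA c (a * b)"
    and scale_mult_right: "a * scaleA c b = scaleA c (a * b)"

(* The actions are bilinear over the ground ring; with unitality this says that both actions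
   induce the given scalar multiplication on the bimodule. *)

locale bimodule = unital_algebra scaleA + M: module scaleM
  for scaleA :: "'k::comm_ring_1 \<Rightarrow> 'a::{ring, monoid_mult} \<Rightarrow> 'a"
    and scaleM :: "'k \<Rightarrow> 'm::ab_group_add \<Rightarrow> 'm" +
  fixes lact :: "'a \<Rightarrow> 'm \<Rightarrow> 'm"  (infixr "\<rhd>" 75)
    and ract :: "'m \<Rightarrow> 'a \<Rightarrow> 'm"  (infixl "\<lhd>" 75)
  assumes lact_add_left: "(a + b) \<rhd> x = a \<rhd> x + b \<rhd> x"
    and lact_add_right: "a \<rhd> (x + y) = a \<rhd> x + a \<rhd> y"
    and lact_scale_left: "scaleA c a \<rhd> x = scaleM c (a \<rhd> x)"
    and lact_scale_right: "a \<rhd> scaleM c x = scaleM c (a \<rhd> x)"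
    and lact_mult: "(a * b) \<rhd> x = a \<rhd> (b \<rhd> x)"
    and lact_one: "1 \<rhd> x = x"
    and ract_add_left: "(x + y) \<lhd> a = x \<lhd> a + y \<lhd> a"
    and ract_add_right: "x \<lhd> (a + b) = x \<lhd> a + x \<lhd> b"
    and ract_scale_left: "scaleM c x \<lhd> a = scaleM c (x \<lhd> a)"
    and ract_scale_right: "x \<lhd> scaleA c a = scaleM c (x \<lhd> a)"
    and ract_mult: "x \<lhd> (a * b) = (x \<lhd> a) \<lhd> b"
    and ract_one: "x \<lhd> 1 = x"
    and lact_ract_assoc: "(a \<rhd> x) \<lhd> b = a \<rhd> (x \<lhd> b)"

locale derivation = bimodule scaleA scaleM lact ract + module_hom scaleA scaleM d
  for scaleA :: "'k::comm_ring_1 \<Rightarrow> 'a::{ring, monoid_mult} \<Rightarrow> 'a"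
    and scaleM :: "'k \<Rightarrow> 'm::ab_group_add \<Rightarrow> 'm"
    and lact :: "'a \<Rightarrow> 'm \<Rightarrow> 'm"  (infixr "\<rhd>" 75)
    and ract :: "'m \<Rightarrow> 'a \<Rightarrow> 'm"  (infixl "\<lhd>" 75)
    and d :: "'a \<Rightarrow> 'm" +
  assumes leibniz: "d (a * b) = d a \<lhd> b + a \<rhd> d b"

definition bimodule_commutator ::
    "('a \<Rightarrow> 'm \<Rightarrow> 'm) \<Rightarrow> ('m \<Rightarrow> 'a \<Rightarrow> 'm) \<Rightarrow> 'm \<Rightarrow> 'a \<Rightarrow> 'm::ab_group_add"
  where "bimodule_commutator lact ract \<gamma> a = ract \<gamma> a - lact a \<gamma>"

end

theory Submission
  imports Defs
begin

text \<open>Applying both derivations to \<open>\<phi> \<Phi> = \<Phi> \<phi>\<^sub>0\<close> and eliminating \<open>dbar \<Phi>\<close> shows that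
  the two expressions are intertwined by \<open>\<Phi>\<close>:
  \<open>(dbar \<phi> - d \<phi> \<phi>) \<Phi> = \<Phi> (dbar \<phi>\<^sub>0 - d \<phi>\<^sub>0 \<phi>\<^sub>0 + [\<gamma>, \<phi>\<^sub>0])\<close>.
  Invertibility of \<open>\<Phi>\<close> then makes one vanish exactly when the other does.\<close>

context bimodule
begin

lemma lact_zero_right [simp]: "a \<rhd> 0 = 0"
  using lact_add_right[of a 0 0] by simp

lemma ract_zero_left [simp]: "0 \<lhd> a = 0"
  using ract_add_left[of 0 0 a] by simp

lemma lact_diff_right: "a \<rhd> (x - y) = a \<rhd> x - a \<rhd> y"
  using lact_add_right[of a "x - y" y] by (simp add: algebra_simps)

lemma ract_diff_left: "(x - y) \<lhd> a = x \<lhd> a - y \<lhd> a"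
  using ract_add_left[of "x - y" y a] by (simp add: algebra_simps)

text \<open>Acting by \<open>b\<close> undoes acting by \<open>a\<close>, as
  \<open>b \<rhd> (a \<rhd> x) = (b * a) \<rhd> x = x\<close>: a left inverse cancels a left
  action.\<close>

lemma lact_eq_0_iff:
  assumes "b * a = 1"
  shows "a \<rhd> x = 0 \<longleftrightarrow> x = 0"
  by (metis assms lact_mult lact_one lact_zero_right)

text \<open>Mirror image: \<open>(x \<lhd> a) \<lhd> b = x \<lhd> (a * b) = x\<close>, so here a
  right inverse cancels.\<close>

lemma ract_eq_0_iff:
  assumes "a * b = 1"
  shows "x \<lhd> a = 0 \<longleftrightarrow> x = 0"
  by (metis assms ract_mult ract_one ract_zero_left)

text \<open>Writing the conjugation as \<open>\<phi> * \<Phi> = \<Phi> * \<phi>\<^sub>0\<close>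
  avoids differentiating an inverse of \<open>\<Phi>\<close>.\<close>

lemma intertwining_identity:
  assumes "derivation scaleA scaleM lact ract d"
    and "derivation scaleA scaleM lact ract dbar"
    and intertwine: "\<phi> * \<Phi> = \<Phi> * \<phi>\<^sub>0"
    and dbar_eq: "dbar \<Phi> = d \<Phi> \<lhd> \<phi>\<^sub>0 + \<Phi> \<rhd> \<gamma>"
  shows "(dbar \<phi> - d \<phi> \<lhd> \<phi>) \<lhd> \<Phi> =
    \<Phi> \<rhd> (dbar \<phi>\<^sub>0 - d \<phi>\<^sub>0 \<lhd> \<phi>\<^sub>0 + bimodule_commutator lact ract \<gamma> \<phi>\<^sub>0)"
proof -
  interpret d: derivation scaleA scaleM lact ract d by fact
  interpret dbar: derivation scaleA scaleM lact ract dbar by fact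
  \<comment> \<open>Expand \<open>d (\<phi> * \<Phi>) = d (\<Phi> * \<phi>\<^sub>0)\<close> by
    Leibniz on both sides and solve for the term containing \<open>d \<phi>\<close>.\<close>
  have d_\<phi>: "d \<phi> \<lhd> \<Phi> = d \<Phi> \<lhd> \<phi>\<^sub>0 + \<Phi> \<rhd> d \<phi>\<^sub>0 - \<phi> \<rhd> d \<Phi>"
    using d.leibniz[of \<phi> \<Phi>] d.leibniz[of \<Phi> \<phi>\<^sub>0] by (simp add: intertwine algebra_simps)
  have dbar_\<phi>: "dbar \<phi> \<lhd> \<Phi> = dbar \<Phi> \<lhd> \<phi>\<^sub>0 + \<Phi> \<rhd> dbar \<phi>\<^sub>0 - \<phi> \<rhd> dbar \<Phi>"
    using dbar.leibniz[of \<phi> \<Phi>] dbar.leibniz[of \<Phi> \<phi>\<^sub>0] by (simp add: intertwine algebra_simps)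
  \<comment> \<open>Moving \<open>\<Phi>\<close> inward past \<open>\<phi>\<close> makes
    \<open>d_\<phi>\<close> applicable to the quadratic term.\<close>
  have "(d \<phi> \<lhd> \<phi>) \<lhd> \<Phi> = (d \<phi> \<lhd> \<Phi>) \<lhd> \<phi>\<^sub>0"
    by (simp add: ract_mult[symmetric] intertwine)
  moreover have "\<phi> \<rhd> (\<Phi> \<rhd> \<gamma>) = \<Phi> \<rhd> (\<phi>\<^sub>0 \<rhd> \<gamma>)"
    by (simp add: lact_mult[symmetric] intertwine)
  \<comment> \<open>After substitution the terms
    \<open>d \<Phi> \<lhd> \<phi>\<^sub>0 \<lhd> \<phi>\<^sub>0\<close> and
    \<open>\<phi> \<rhd> (d \<Phi> \<lhd> \<phi>\<^sub>0)\<close> cancel; the two terms in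
    \<open>\<gamma>\<close> form \<open>\<Phi>\<close> acting on the commutator.\<close>
  ultimately show ?thesis
    by (simp add: d_\<phi> dbar_\<phi> dbar_eq bimodule_commutator_def lact_diff_right ract_diff_left
        lact_add_right ract_add_left lact_ract_assoc)
qed

end

theorem mainTheorem2:
  fixes scaleA :: "'k::comm_ring_1 \<Rightarrow> 'a::{ring, monoid_mult} \<Rightarrow> 'a"
    and scaleM :: "'k \<Rightarrow> 'm::ab_group_add \<Rightarrow> 'm"
    and lact :: "'a \<Rightarrow> 'm \<Rightarrow> 'm"  (infixr "\<rhd>" 75)
    and ract :: "'m \<Rightarrow> 'a \<Rightarrow> 'm"  (infixl "\<lhd>" 75)
    and d dbar :: "'a \<Rightarrow> 'm"
    and \<phi>\<^sub>0 \<Phi> \<Phi>inv \<phi> :: 'a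
    and \<gamma> :: 'm
  assumes "bimodule scaleA scaleM lact ract"
    and "derivation scaleA scaleM lact ract d"
    and "derivation scaleA scaleM lact ract dbar"
    and "\<Phi> * \<Phi>inv = 1" and "\<Phi>inv * \<Phi> = 1"
    and "dbar \<Phi> - d \<Phi> \<lhd> \<phi>\<^sub>0 - \<Phi> \<rhd> \<gamma> = 0"
    and "\<phi> = \<Phi> * \<phi>\<^sub>0 * \<Phi>inv"
  shows "(dbar \<phi> - d \<phi> \<lhd> \<phi> = 0 \<longleftrightarrow>
           dbar \<phi>\<^sub>0 - d \<phi>\<^sub>0 \<lhd> \<phi>\<^sub>0 + bimodule_commutator lact ract \<gamma> \<phi>\<^sub>0 = 0)
       \<and> (dbar \<phi>\<^sub>0 - d \<phi>\<^sub>0 \<lhd> \<phi>\<^sub>0 + bimodule_commutator lact ract \<gamma> \<phi>\<^sub>0 = 0 \<longrightarrow>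
           dbar \<phi> - d \<phi> \<lhd> \<phi> = 0)"
proof -
  interpret bimodule scaleA scaleM lact ract by fact
  have "\<phi> * \<Phi> = \<Phi> * \<phi>\<^sub>0"
    using assms(5,7) by (simp add: mult.assoc)
  moreover have "dbar \<Phi> = d \<Phi> \<lhd> \<phi>\<^sub>0 + \<Phi> \<rhd> \<gamma>"
    using assms(6) by (simp add: algebra_simps)
  ultimately have "(dbar \<phi> - d \<phi> \<lhd> \<phi>) \<lhd> \<Phi> =
      \<Phi> \<rhd> (dbar \<phi>\<^sub>0 - d \<phi>\<^sub>0 \<lhd> \<phi>\<^sub>0 + bimodule_commutator lact ract \<gamma> \<phi>\<^sub>0)"
    by (rule intertwining_identity[OF assms(2,3)])
  then show ?thesis
    using lact_eq_0_iff[OF assms(5)] ract_eq_0_iff[OF assms(4)] by metis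
qed

end
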